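(* In the level zero super Fock representation with spectral parameter $u$, for every super partition $\Lambda$ the eigenvalues of the commuting Hamiltonians $H_{1,\pm1},H_{2,\pm1}$ on the basis vector labelled by $\Lambda$ satisfy $$1-u(t/q)^{1/2}H_{2,-1}=(t-1)(q^{-1}-1)\sum_{(i,j)\in\Lambda^{\circledast}}q^{1-j}t^{i-1},$$ $$1+uH_{1,-1}=(t-1)(q^{-1}-1)\sum_{(i,j)\in\Lambda^{*}}q^{1-j}t^{i-1},$$ $$1+u^{-1}(q/t)^{1/2}H_{2,+1}=(t^{-1}-1)(q-1)\sum_{(i,j)\in\Lambda^{\circledast}}q^{j-1}t^{1-i},$$ $$1-u^{-1}H_{1,+1}=(t^{-1}-1)(q-1)\sum_{(i,j)\in\Lambda^{*}}q^{j-1}t^{1-i}.$$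
   Context: $q,t,u$ are generic parameters (with chosen square roots of $q$ and $t$). A super partition is a non-increasing sequence $\Lambda_1\ge\Lambda_2\ge\dots\ge\Lambda_{\ell}>0$, $\Lambda_{\ell+1}=0$, of elements of $\frac12\mathbb Z_{\ge0}$ such that if $\Lambda_k\notin\mathbb Z$ then $\Lambda_{k-1}>\Lambda_k>\Lambda_{k+1}$. Put $\sigma_i=0$ if $\Lambda_i\in\mathbb Z$ and $\sigma_i=1$ otherwise. $\Lambda^{\circledast}$ and $\Lambda^{*}$ are the ordinary partitions with parts $\lambda_i:=\Lambda_i+\frac12\sigma_i$ and $\Lambda_i-\frac12\sigma_i=\lambda_i-\sigma_i$, respectively. $(i,j)$ in a partition $\mu$ means a box in row $i$ and column $j$, $1\le j\le\mu_i$. Let $\ell(\lambda)$ be the number of nonzero $\lambda_i$. The super Fock representation of the (shifted) quantum toroidal algebra of type $\mathfrak{gl}_{1|1}$ has a basis labelled by super partitions, identified with the super Macdonald polynomials, on which the Cartan currents act diagonally. (It is the infinite tensor product of vector representations with spectral parameters $ut^{1-i}$, $i\ge1$, the infinite products of eigenvalues being regularized by telescoping cancellation.) On the basis vector labelled by $\Lambda$ they act by the rational functions $$K_1(z)=\frac{1}{z-t^{-\ell(\lambda)}u}\prod_{i=1}^{\ell(\lambda)}\frac{z-q^{\lambda_i-\sigma_i}t^{-i}u}{z-q^{\lambda_i-\sigma_i}t^{1-i}u},\qquad K_2(z)=\left(z-(t/q)^{1/2}t^{-\ell(\lambda)}u\right)\prod_{i=1}^{\ell(\lambda)}\frac{z-q^{\lambda_i-\frac12}t^{\frac32-i}u}{z-q^{\lambda_i-\frac12}t^{\frac12-i}u}.$$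 The Hamiltonians are defined by expanding these functions: near $z=0$, $$K_i(z)=K_i^-(z)=K_{i,0}^-\exp\Big(-\sum_{r\ge1}H_{i,-r}z^{r}\Big),\quad i=1,2,$$ and near $z=\infty$, with shift parameters $r_1=-1$, $r_2=1$, $$K_i(z)=z^{r_i}K_i^+(z),\qquad K_i^+(z)=K_{i,0}^+\exp\Big(\sum_{r\ge1}H_{i,r}z^{-r}\Big),\quad i=1,2,$$ where $K_{i,0}^{\pm}$ are the leading coefficients (so $K^+_{1,0}=K^+_{2,0}=1$). *)

theory Defs
  imports
    Complex_Main
    "HOL-Computational_Algebra.Computational_Algebra"
begin

section \<open>Super partitions\<close>

text \<open>
  A super partition is the list of its nonzero parts. \<open>part \<Lambda> i\<close> is the \<open>i\<close>-th part, counted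
  from \<open>1\<close>, and is \<open>0\<close> beyond the length of the list (and at \<open>i = 0\<close>).
\<close>

definition part :: "rat list \<Rightarrow> nat \<Rightarrow> rat" where
  "part \<Lambda> i = (if 1 \<le> i \<and> i \<le> length \<Lambda> then \<Lambda> ! (i - 1) else 0)"

text \<open>The condition \<open>\<Lambda>\<^sub>k\<^sub>-\<^sub>1 > \<Lambda>\<^sub>k\<close> at a half-integral part is void for \<open>k = 1\<close>.\<close>

definition super_partition :: "rat list \<Rightarrow> bool" where
  "super_partition \<Lambda> \<longleftrightarrow>
     (\<forall>x\<in>set \<Lambda>. x > 0 \<and> 2 * x \<in> \<int>) \<and>
     sorted_wrt (\<ge>) \<Lambda> \<and>
     (\<forall>k. 1 \<le> k \<and> k \<le> length \<Lambda> \<and> part \<Lambda> k \<notin> \<int> \<longrightarrow>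
        (k > 1 \<longrightarrow> part \<Lambda> (k - 1) > part \<Lambda> k) \<and> part \<Lambda> k > part \<Lambda> (k + 1))"

definition sgm :: "rat list \<Rightarrow> nat \<Rightarrow> nat" where
  "sgm \<Lambda> i = (if part \<Lambda> i \<in> \<int> then 0 else 1)"

text \<open>
  The parts of \<open>\<Lambda>\<^sup>\<circledast>\<close> and \<open>\<Lambda>\<^sup>*\<close>. On a super partition the arguments of the floor functions are
  nonnegative integers, so \<open>floor\<close> and \<open>nat\<close> only change the type.
\<close>

definition circ_part :: "rat list \<Rightarrow> nat \<Rightarrow> nat" where
  "circ_part \<Lambda> i = nat \<lfloor>part \<Lambda> i + of_nat (sgm \<Lambda> i) / 2\<rfloor>"

definition star_part :: "rat list \<Rightarrow> nat \<Rightarrow> nat" where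
  "star_part \<Lambda> i = nat \<lfloor>part \<Lambda> i - of_nat (sgm \<Lambda> i) / 2\<rfloor>"

definition plength :: "(nat \<Rightarrow> nat) \<Rightarrow> nat" where
  "plength \<mu> = card {i. 1 \<le> i \<and> \<mu> i \<noteq> 0}"

definition boxes :: "(nat \<Rightarrow> nat) \<Rightarrow> (nat \<times> nat) set" where
  "boxes \<mu> = {(i, j). 1 \<le> i \<and> 1 \<le> j \<and> j \<le> \<mu> i}"


section \<open>Rational functions and their expansions\<close>

abbreviation zvar :: "'k::field poly fract" where
  "zvar \<equiv> Fract [:0, 1:] 1"

abbreviation cst :: "'k::field \<Rightarrow> 'k poly fract" where
  "cst c \<equiv> Fract [:c:] 1"

definition fls_subst :: "'k::field fls \<Rightarrow> 'k poly \<Rightarrow> 'k fls" where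
  "fls_subst x p = poly (map_poly fls_const p) x"

lemma fls_subst_altdef:
  "fls_subst x p = (\<Sum>i\<le>degree p. fls_const (coeff p i) * x ^ i)"
  by (simp add: fls_subst_def poly_altdef coeff_map_poly degree_map_poly)

lemma fls_subst_mult: "fls_subst x (p * r) = fls_subst x p * fls_subst x r"
proof -
  have "map_poly fls_const (p * r) = map_poly fls_const p * map_poly fls_const r"
    by (intro poly_eqI) (simp add: coeff_map_poly coeff_mult fls_eq_iff fls_nth_sum)
  thus ?thesis
    by (simp add: fls_subst_def)
qed

lemma fls_subst_X_nonzero:
  assumes "p \<noteq> 0" shows "fls_subst fls_X p \<noteq> 0"
proof -
  have "fls_nth (fls_subst fls_X p) (int (degree p)) = lead_coeff p"
    by (simp add: fls_subst_altdef fls_nth_sum if_distrib [of "(*) _"] cong: if_cong)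
  thus ?thesis using assms by auto
qed

lemma fls_subst_X_inv_nonzero:
  assumes "p \<noteq> 0" shows "fls_subst fls_X_inv p \<noteq> 0"
proof -
  have "fls_nth (fls_subst fls_X_inv p) (- int (degree p)) = lead_coeff p"
    by (simp add: fls_subst_altdef fls_nth_sum if_distrib [of "(*) _"] cong: if_cong)
  thus ?thesis using assms by auto
qed

text \<open>
  The Laurent expansions of a rational function at \<open>0\<close> and at \<open>\<infinity>\<close>; by \<open>expand_zero_Fract\<close> and
  \<open>expand_inf_Fract\<close> they do not depend on the chosen fraction.
\<close>

definition expand_zero :: "'k::field poly fract \<Rightarrow> 'k fls" where
  "expand_zero R = (THE F. \<exists>p r. r \<noteq> 0 \<and> R = Fract p r \<and>
     F = fls_subst fls_X p / fls_subst fls_X r)"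

lemma expand_zero_Fract:
  assumes "r \<noteq> 0"
  shows "expand_zero (Fract p r) = fls_subst fls_X p / fls_subst fls_X r"
  unfolding expand_zero_def
proof (rule the_equality)
  show "\<exists>p' r'. r' \<noteq> 0 \<and> Fract p r = Fract p' r' \<and>
     fls_subst fls_X p / fls_subst fls_X r = fls_subst fls_X p' / fls_subst fls_X r'"
    by (intro exI [of _ p] exI [of _ r] conjI refl assms)
next
  fix F assume "\<exists>p' r'. r' \<noteq> 0 \<and> Fract p r = Fract p' r' \<and>
     F = fls_subst fls_X p' / fls_subst fls_X r'"
  then obtain p' r' where *: "r' \<noteq> 0" "Fract p r = Fract p' r'"
      "F = fls_subst fls_X p' / fls_subst fls_X r'" by (elim exE conjE)
  have "p * r' = p' * r"
    using iffD1 [OF eq_fract(1) [OF assms *(1)] *(2)] .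
  hence "fls_subst fls_X p * fls_subst fls_X r' = fls_subst fls_X p' * fls_subst fls_X r"
    by (simp only: fls_subst_mult [symmetric])
  hence "fls_subst fls_X p / fls_subst fls_X r = fls_subst fls_X p' / fls_subst fls_X r'"
    by (rule iffD2 [OF frac_eq_eq
      [OF fls_subst_X_nonzero [OF assms] fls_subst_X_nonzero [OF *(1)]]])
  with *(3) show "F = fls_subst fls_X p / fls_subst fls_X r"
    by (rule trans [OF _ sym])
qed

text \<open>
  The series variable of \<open>expand_inf R\<close> stands for \<open>z\<^sup>-\<^sup>1\<close>: the coefficient with index \<open>n\<close> belongs
  to \<open>z\<^sup>-\<^sup>n\<close>.
\<close>

definition expand_inf :: "'k::field poly fract \<Rightarrow> 'k fls" where
  "expand_inf R = (THE F. \<exists>p r. r \<noteq> 0 \<and> R = Fract p r \<and>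
     F = fls_subst fls_X_inv p / fls_subst fls_X_inv r)"

lemma expand_inf_Fract:
  assumes "r \<noteq> 0"
  shows "expand_inf (Fract p r) = fls_subst fls_X_inv p / fls_subst fls_X_inv r"
  unfolding expand_inf_def
proof (rule the_equality)
  show "\<exists>p' r'. r' \<noteq> 0 \<and> Fract p r = Fract p' r' \<and>
     fls_subst fls_X_inv p / fls_subst fls_X_inv r = fls_subst fls_X_inv p' / fls_subst fls_X_inv r'"
    by (intro exI [of _ p] exI [of _ r] conjI refl assms)
next
  fix F assume "\<exists>p' r'. r' \<noteq> 0 \<and> Fract p r = Fract p' r' \<and>
     F = fls_subst fls_X_inv p' / fls_subst fls_X_inv r'"
  then obtain p' r' where *: "r' \<noteq> 0" "Fract p r = Fract p' r'"
      "F = fls_subst fls_X_inv p' / fls_subst fls_X_inv r'" by (elim exE conjE)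
  have "p * r' = p' * r"
    using iffD1 [OF eq_fract(1) [OF assms *(1)] *(2)] .
  hence "fls_subst fls_X_inv p * fls_subst fls_X_inv r' = fls_subst fls_X_inv p' * fls_subst fls_X_inv r"
    by (simp only: fls_subst_mult [symmetric])
  hence "fls_subst fls_X_inv p / fls_subst fls_X_inv r = fls_subst fls_X_inv p' / fls_subst fls_X_inv r'"
    by (rule iffD2 [OF frac_eq_eq
      [OF fls_subst_X_inv_nonzero [OF assms] fls_subst_X_inv_nonzero [OF *(1)]]])
  with *(3) show "F = fls_subst fls_X_inv p / fls_subst fls_X_inv r"
    by (rule trans [OF _ sym])
qed


section \<open>Eigenvalues of the Cartan currents\<close>

text \<open>
  \<open>sq\<close> and \<open>st\<close> are the chosen square roots of \<open>q\<close> and \<open>t\<close>; a half-integral power such as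
  \<open>q\<close> to the \<open>\<lambda>\<^sub>i - 1/2\<close> is an integral power of \<open>sq\<close>.
\<close>

definition generic_parameters :: "'k::field \<Rightarrow> 'k \<Rightarrow> 'k \<Rightarrow> 'k \<Rightarrow> 'k \<Rightarrow> bool" where
  "generic_parameters q t u sq st \<longleftrightarrow>
     q \<noteq> 0 \<and> t \<noteq> 0 \<and> u \<noteq> 0 \<and> sq ^ 2 = q \<and> st ^ 2 = t \<and>
     (\<forall>a b :: int. q powi a * t powi b = 1 \<longrightarrow> a = 0 \<and> b = 0)"

definition K1 :: "'k::field \<Rightarrow> 'k \<Rightarrow> 'k \<Rightarrow> rat list \<Rightarrow> 'k poly fract" where
  "K1 q t u \<Lambda> = (let l = plength (circ_part \<Lambda>) in
     1 / (zvar - cst (t powi (- int l) * u)) *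
     (\<Prod>i=1..l.
        (zvar - cst (q powi (int (circ_part \<Lambda> i) - int (sgm \<Lambda> i)) * t powi (- int i) * u)) /
        (zvar - cst (q powi (int (circ_part \<Lambda> i) - int (sgm \<Lambda> i)) * t powi (1 - int i) * u))))"

definition K2 :: "'k::field \<Rightarrow> 'k \<Rightarrow> 'k \<Rightarrow> 'k \<Rightarrow> rat list \<Rightarrow> 'k poly fract" where
  "K2 sq st t u \<Lambda> = (let l = plength (circ_part \<Lambda>) in
     (zvar - cst (st / sq * t powi (- int l) * u)) *
     (\<Prod>i=1..l.
        (zvar - cst (sq powi (2 * int (circ_part \<Lambda> i) - 1) * st powi (3 - 2 * int i) * u)) /
        (zvar - cst (sq powi (2 * int (circ_part \<Lambda> i) - 1) * st powi (1 - 2 * int i) * u))))"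

definition K_eig :: "'k::field \<Rightarrow> 'k \<Rightarrow> 'k \<Rightarrow> 'k \<Rightarrow> 'k \<Rightarrow> nat \<Rightarrow> rat list \<Rightarrow> 'k poly fract" where
  "K_eig q t u sq st i \<Lambda> = (if i = 1 then K1 q t u \<Lambda> else K2 sq st t u \<Lambda>)"

definition shift_param :: "nat \<Rightarrow> int" where
  "shift_param i = (if i = 1 then -1 else 1)"


section \<open>Power series with operator coefficients\<close>

text \<open>A sequence \<open>A\<close> of operators stands for \<open>\<Sum>n. A n * w ^ n\<close> in one formal variable \<open>w\<close>.\<close>

type_synonym 'v op_series = "nat \<Rightarrow> 'v \<Rightarrow> 'v"

definition ops_mult :: "'v::ab_group_add op_series \<Rightarrow> 'v op_series \<Rightarrow> 'v op_series" where
  "ops_mult A B n v = (\<Sum>i\<le>n. A i (B (n - i) v))"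

primrec ops_power :: "'v::ab_group_add op_series \<Rightarrow> nat \<Rightarrow> 'v op_series" where
  "ops_power A 0 = (\<lambda>n v. if n = 0 then v else 0)"
| "ops_power A (Suc k) = ops_mult A (ops_power A k)"

text \<open>
  The exponential of a series without constant term; its \<open>k\<close>-th power then has no terms of
  degree less than \<open>k\<close>, which makes the sum over \<open>k\<close> finite.
\<close>

definition ops_exp ::
  "('k::field_char_0 \<Rightarrow> 'v \<Rightarrow> 'v) \<Rightarrow> 'v::ab_group_add op_series \<Rightarrow> 'v op_series" where
  "ops_exp scale A n v = (\<Sum>k\<le>n. scale (inverse (fact k)) (ops_power A k n v))"


section \<open>The Cartan part of the super Fock representation\<close>

text \<open>
  \<open>ket \<Lambda>\<close> is the basis vector labelled by \<open>\<Lambda>\<close>. \<open>Km i n\<close> is the coefficient of \<open>z\<^sup>n\<close> in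
  \<open>K\<^sub>i\<^sup>-(z)\<close> and \<open>Kp i n\<close> that of \<open>z\<^sup>-\<^sup>n\<close> in \<open>K\<^sub>i\<^sup>+(z)\<close>. Since \<open>K\<^sub>i(z) = z\<^sup>r K\<^sub>i\<^sup>+(z)\<close>, with
  \<open>r = shift_param i\<close>, the latter is the coefficient of \<open>z\<close> to the \<open>r - n\<close> in \<open>K\<^sub>i(z)\<close>.
  \<open>H i r\<close>, for \<open>r \<noteq> 0\<close>, are the Hamiltonians; \<open>H i 0\<close> plays no role.
\<close>

locale super_fock = vector_space scale
  for scale :: "'k::field_char_0 \<Rightarrow> 'v::ab_group_add \<Rightarrow> 'v" +
  fixes q t u sq st :: 'k
    and ket :: "rat list \<Rightarrow> 'v"
    and Km Kp :: "nat \<Rightarrow> 'v op_series"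
    and H :: "nat \<Rightarrow> int \<Rightarrow> 'v \<Rightarrow> 'v"
  assumes generic: "generic_parameters q t u sq st"
    and ket_inj: "inj_on ket {\<Lambda>. super_partition \<Lambda>}"
    and ket_independent: "independent (ket ` {\<Lambda>. super_partition \<Lambda>})"
    and ket_span: "span (ket ` {\<Lambda>. super_partition \<Lambda>}) = UNIV"
    and Km_linear: "i \<in> {1, 2} \<Longrightarrow> Vector_Spaces.linear scale scale (Km i n)"
    and Kp_linear: "i \<in> {1, 2} \<Longrightarrow> Vector_Spaces.linear scale scale (Kp i n)"
    and H_linear: "i \<in> {1, 2} \<Longrightarrow> r \<noteq> 0 \<Longrightarrow> Vector_Spaces.linear scale scale (H i r)"
    and H_commute: "i \<in> {1, 2} \<Longrightarrow> j \<in> {1, 2} \<Longrightarrow> r \<noteq> 0 \<Longrightarrow> s \<noteq> 0 \<Longrightarrow> H i r \<circ> H j s = H j s \<circ> H i r"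
    and Km_ket: "i \<in> {1, 2} \<Longrightarrow> super_partition \<Lambda> \<Longrightarrow>
      Km i n (ket \<Lambda>) =
        scale (fls_nth (expand_zero (K_eig q t u sq st i \<Lambda>)) (int n)) (ket \<Lambda>)"
    and Kp_ket: "i \<in> {1, 2} \<Longrightarrow> super_partition \<Lambda> \<Longrightarrow>
      Kp i n (ket \<Lambda>) =
        scale (fls_nth (expand_inf (K_eig q t u sq st i \<Lambda>)) (int n - shift_param i)) (ket \<Lambda>)"
    and Km_exp: "i \<in> {1, 2} \<Longrightarrow>
      Km i n v = Km i 0 (ops_exp scale (\<lambda>r v. if r = 0 then 0 else - H i (- int r) v) n v)"
    and Kp_exp: "i \<in> {1, 2} \<Longrightarrow>
      Kp i n v = Kp i 0 (ops_exp scale (\<lambda>r v. if r = 0 then 0 else H i (int r) v) n v)"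

end

theory Submission
  imports Defs
begin

text \<open>
  The coefficient of \<open>w\<close> in the logarithm of a series \<open>c (1 + h w + \<dots>)\<close> is \<open>h\<close>, so a Hamiltonian
  \<open>H\<^sub>i\<^sub>,\<^sub>\<plusminus>\<^sub>1\<close> is read off from the first two coefficients of \<open>K\<^sub>i\<close>. Taking \<open>h\<close> turns products into
  sums. A factor \<open>z - a\<close> contributes \<open>- 1 / a\<close> at \<open>z = 0\<close> and, in the variable \<open>1 / z\<close>, \<open>- a\<close> at
  \<open>z = \<infinity>\<close>. Each of the four eigenvalues is thus a prefactor term in \<open>t\<^sup>l\<close> or \<open>t\<^sup>-\<^sup>l\<close>, where \<open>l\<close> is
  the number of rows, plus one term for each row, with a power of \<open>q\<close> that is given by the length of
  the row (\<open>log_expansion_K1\<close>, \<open>log_expansion_K2\<close>).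

  These sums over rows are the sums over boxes on the other side. Summing a geometric series along
  each row leaves \<open>q\<close> to the row length, minus \<open>1\<close>; the terms \<open>- 1\<close> add up, over the rows, to a
  second geometric series, which is the prefactor term together with the summand \<open>1\<close> on the left
  (\<open>sum_boxes_geometric\<close>). The exponents of
  \<open>q\<close> are the rows of \<open>\<Lambda>\<^sup>*\<close> in \<open>K\<^sub>1\<close> and, once the shift by one half has been absorbed in the spectral
  parameter, the rows of \<open>\<Lambda>\<^sup>\<circledast>\<close> in \<open>K\<^sub>2\<close>.

  The operator identity defining \<open>H\<^sub>i\<^sub>,\<^sub>\<plusminus>\<^sub>1\<close> involves the leading mode of \<open>K\<^sub>i\<^sup>\<plusminus>\<close>, applied to a vector
  not yet known to be a multiple of the basis vector. The leading modes can be cancelled because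
  the products over rows telescope: the leading coefficients do not depend on \<open>\<Lambda>\<close>, so these modes
  are nonzero scalars on the whole space (\<open>scalar_on_kets\<close>, \<open>H_minus_one_ket\<close>, \<open>H_plus_one_ket\<close>).
\<close>


section \<open>Multiplicativity of the expansions\<close>

lemma expand_zero_mult: "expand_zero (R * S) = expand_zero R * expand_zero S"
proof -
  obtain a b where R: "R = Fract a b" "b \<noteq> 0" by (cases R) auto
  obtain c d where S: "S = Fract c d" "d \<noteq> 0" by (cases S) auto
  show ?thesis
    using R(2) S(2) by (simp add: R(1) S(1) expand_zero_Fract fls_subst_mult)
qed

lemma expand_inf_mult: "expand_inf (R * S) = expand_inf R * expand_inf S"
proof -
  obtain a b where R: "R = Fract a b" "b \<noteq> 0" by (cases R) auto
  obtain c d where S: "S = Fract c d" "d \<noteq> 0" by (cases S) auto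
  show ?thesis
    using R(2) S(2) by (simp add: R(1) S(1) expand_inf_Fract fls_subst_mult)
qed

lemma expand_zero_one: "expand_zero 1 = 1"
  by (simp add: One_fract_def expand_zero_Fract fls_subst_X_nonzero)

lemma expand_inf_one: "expand_inf 1 = 1"
  by (simp add: One_fract_def expand_inf_Fract fls_subst_X_inv_nonzero)

lemma expand_zero_divide:
  assumes "S \<noteq> 0"
  shows "expand_zero (R / S) = expand_zero R / expand_zero S"
proof -
  have "expand_zero S * expand_zero (1 / S) = 1"
    using assms by (simp flip: expand_zero_mult add: expand_zero_one)
  moreover have "expand_zero (R / S) = expand_zero R * expand_zero (1 / S)"
    by (simp flip: expand_zero_mult)
  ultimately show ?thesis
    by (metis inverse_unique divide_inverse)
qed

lemma expand_inf_divide: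
  assumes "S \<noteq> 0"
  shows "expand_inf (R / S) = expand_inf R / expand_inf S"
proof -
  have "expand_inf S * expand_inf (1 / S) = 1"
    using assms by (simp flip: expand_inf_mult add: expand_inf_one)
  moreover have "expand_inf (R / S) = expand_inf R * expand_inf (1 / S)"
    by (simp flip: expand_inf_mult)
  ultimately show ?thesis
    by (metis inverse_unique divide_inverse)
qed


section \<open>Logarithmic expansions to first order\<close>

text \<open>
  Says that \<open>F = w\<^sup>n c (1 + h w + O(w\<^sup>2))\<close> in the series variable \<open>w\<close>, so that \<open>h\<close> is the first
  coefficient of the logarithm of \<open>F\<close> after its leading monomial has been divided out. Passing through
  a power series makes the vanishing of the coefficients below \<open>n\<close> part of the definition.
\<close>

definition log_expansion :: "'k::field fls \<Rightarrow> int \<Rightarrow> 'k \<Rightarrow> 'k \<Rightarrow> bool" where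
  "log_expansion F n c h \<longleftrightarrow>
     c \<noteq> 0 \<and> (\<exists>G. F = fls_shift (- n) (fps_to_fls G) \<and> fps_nth G 0 = c \<and> fps_nth G 1 = c * h)"

lemma log_expansion_nth:
  assumes "log_expansion F n c h"
  shows "fls_nth F n = c" "fls_nth F (n + 1) = c * h" "c \<noteq> 0"
  using assms by (auto simp: log_expansion_def)

lemma log_expansion_one: "log_expansion 1 0 1 0"
  unfolding log_expansion_def by (auto intro!: exI [of _ 1])

text \<open>
  The exponent \<open>n\<close> and the logarithmic coefficient \<open>h\<close> are additive, the leading coefficient is
  multiplicative; this reduces the currents to their linear factors.
\<close>

lemma log_expansion_mult:
  assumes "log_expansion F m c h" "log_expansion G n d k"
  shows "log_expansion (F * G) (m + n) (c * d) (h + k)"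
proof -
  obtain F' where F': "F = fls_shift (- m) (fps_to_fls F')" "fps_nth F' 0 = c" "fps_nth F' 1 = c * h"
    using assms(1) by (auto simp: log_expansion_def)
  obtain G' where G': "G = fls_shift (- n) (fps_to_fls G')" "fps_nth G' 0 = d" "fps_nth G' 1 = d * k"
    using assms(2) by (auto simp: log_expansion_def)
  have "F * G = fls_shift (- (m + n)) (fps_to_fls (F' * G'))"
    by (simp add: F'(1) G'(1) fls_times_both_shifted_simp fls_times_fps_to_fls algebra_simps)
  moreover have "fps_nth (F' * G') 1 = (c * d) * (h + k)"
    using F'(2,3) G'(2,3) by (simp add: fps_mult_nth algebra_simps)
  ultimately show ?thesis
    using assms F'(2) G'(2) unfolding log_expansion_def
    by (auto intro!: exI [of _ "F' * G'"])
qed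

lemma log_expansion_inverse:
  assumes "log_expansion F n c h"
  shows "log_expansion (inverse F) (- n) (inverse c) (- h)"
proof -
  obtain G where G: "F = fls_shift (- n) (fps_to_fls G)" "fps_nth G 0 = c" "fps_nth G 1 = c * h"
    and c: "c \<noteq> 0"
    using assms by (auto simp: log_expansion_def)
  have inv: "G * inverse G = 1"
    using G(2) c by (simp add: inverse_mult_eq_1')
  have "F * fls_shift n (fps_to_fls (inverse G)) = 1"
    by (simp add: G(1) fls_times_both_shifted_simp inv flip: fls_times_fps_to_fls)
  hence "inverse F = fls_shift n (fps_to_fls (inverse G))"
    by (rule inverse_unique)
  moreover have nth0: "fps_nth (inverse G) 0 = inverse c"
    using G(2) by simp
  moreover have "fps_nth (inverse G) 1 = inverse c * (- h)"
  proof -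
    have "fps_nth (G * inverse G) 1 = 0" by (simp add: inv)
    hence "c * fps_nth (inverse G) 1 + c * h * inverse c = 0"
      using G(2,3) nth0 by (simp add: fps_mult_nth)
    thus ?thesis using c by (simp add: field_simps eq_neg_iff_add_eq_0)
  qed
  ultimately show ?thesis
    using c unfolding log_expansion_def by auto
qed

lemma log_expansion_divide:
  assumes "log_expansion F m c h" "log_expansion G n d k"
  shows "log_expansion (F / G) (m - n) (c / d) (h - k)"
  using log_expansion_mult [OF assms(1) log_expansion_inverse [OF assms(2)]]
  by (simp add: divide_inverse)

lemma linear_factor_eq: "zvar - cst a = Fract [:- a, 1:] 1"
  by simp

lemma linear_factor_nonzero: "zvar - cst a \<noteq> 0"
  by (simp add: Zero_fract_def eq_fract)

lemma log_expansion_zero_linear: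
  fixes a :: "'k::field"
  assumes "a \<noteq> 0"
  shows "log_expansion (expand_zero (zvar - cst a)) 0 (- a) (- inverse a)"
proof -
  have "expand_zero (zvar - cst a) = fls_X - fls_const a"
    unfolding linear_factor_eq
    by (simp add: expand_zero_Fract fls_subst_def map_poly_pCons fls_minus_const)
  also have "\<dots> = fls_shift (- 0) (fps_to_fls (fps_X - fps_const a))"
    by simp
  finally show ?thesis
    using assms unfolding log_expansion_def by (auto intro!: exI [of _ "fps_X - fps_const a"])
qed

text \<open>
  At infinity \<open>z = w\<^sup>-\<^sup>1\<close>, hence \<open>z - a = w\<^sup>-\<^sup>1 (1 - a w)\<close>: the leading coefficient is \<open>1\<close> for every
  \<open>a\<close>, and the factor has a simple pole.
\<close>

lemma log_expansion_inf_linear: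
  "log_expansion (expand_inf (zvar - cst a)) (- 1) 1 (- a)"
proof -
  have "expand_inf (zvar - cst a) = fls_X_inv - fls_const a"
    unfolding linear_factor_eq
    by (simp add: expand_inf_Fract fls_subst_def map_poly_pCons fls_minus_const)
  also have "\<dots> = fls_shift (- (- 1)) (fps_to_fls (1 - fps_const a * fps_X))"
    by (rule fls_eqI) (auto simp: fps_X_def nat_eq_iff)
  finally show ?thesis
    unfolding log_expansion_def by (auto intro!: exI [of _ "1 - fps_const a * fps_X"])
qed

lemma log_expansion_zero_prod:
  assumes "\<And>i. i \<in> A \<Longrightarrow> a i \<noteq> 0" "\<And>i. i \<in> A \<Longrightarrow> b i \<noteq> 0"
  shows "log_expansion (expand_zero (\<Prod>i\<in>A. (zvar - cst (a i)) / (zvar - cst (b i)))) 0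
           (\<Prod>i\<in>A. a i / b i) (\<Sum>i\<in>A. inverse (b i) - inverse (a i))"
  using assms
proof (induction A rule: infinite_finite_induct)
  case (insert x A)
  have "log_expansion (expand_zero ((zvar - cst (a x)) / (zvar - cst (b x)))) 0
          (a x / b x) (inverse (b x) - inverse (a x))"
    using log_expansion_divide [OF log_expansion_zero_linear log_expansion_zero_linear, of "a x" "b x"]
      insert.prems by (simp add: expand_zero_divide [OF linear_factor_nonzero] del: diff_fract)
  from log_expansion_mult [OF this insert.IH] insert show ?case
    by (simp flip: expand_zero_mult del: diff_fract)
qed (simp_all add: expand_zero_one log_expansion_one)

lemma log_expansion_inf_prod:
  "log_expansion (expand_inf (\<Prod>i\<in>A. (zvar - cst (a i)) / (zvar - cst (b i)))) 0
     1 (\<Sum>i\<in>A. b i - a i)"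
proof (induction A rule: infinite_finite_induct)
  case (insert x A)
  have "log_expansion (expand_inf ((zvar - cst (a x)) / (zvar - cst (b x)))) 0 1 (b x - a x)"
    using log_expansion_divide [OF log_expansion_inf_linear log_expansion_inf_linear, of "a x" "b x"]
    by (simp add: expand_inf_divide [OF linear_factor_nonzero] del: diff_fract)
  from log_expansion_mult [OF this insert.IH] insert show ?case
    by (simp flip: expand_inf_mult del: diff_fract)
qed (simp_all add: expand_inf_one log_expansion_one)


section \<open>The parts of a super partition\<close>

text \<open>
  The bound keeps the arguments of the floor functions nonnegative, so that the truncation in the
  definitions of \<open>circ_part\<close> and \<open>star_part\<close> is never active.
\<close>

lemma super_partition_part_ge:
  assumes "super_partition \<Lambda>" "i \<in> {1..length \<Lambda>}"
  shows "part \<Lambda> i \<ge> 1 / 2"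
proof -
  have "part \<Lambda> i \<in> set \<Lambda>" using assms(2) by (auto simp: part_def)
  hence "part \<Lambda> i > 0" "2 * part \<Lambda> i \<in> \<int>" using assms(1) by (auto simp: super_partition_def)
  from this(2) obtain m :: int where "2 * part \<Lambda> i = of_int m" by (auto elim: Ints_cases)
  moreover from this \<open>part \<Lambda> i > 0\<close> have "m \<ge> 1"
    using of_int_0_less_iff [of m, where 'a = rat] by linarith
  ultimately show ?thesis
    using of_int_1_le_iff [of m, where 'a = rat] by linarith
qed

lemma circ_part_pos:
  assumes "super_partition \<Lambda>" "i \<in> {1..length \<Lambda>}"
  shows "circ_part \<Lambda> i > 0"
proof (cases "part \<Lambda> i \<in> \<int>")
  case True
  then obtain m :: int where "part \<Lambda> i = of_int m" by (auto elim: Ints_cases)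
  with True super_partition_part_ge [OF assms] show ?thesis
    by (simp add: circ_part_def sgm_def)
next
  case False
  with super_partition_part_ge [OF assms] show ?thesis
    by (simp add: circ_part_def sgm_def le_floor_iff)
qed

text \<open>
  The right-hand side is the exponent of \<open>q\<close> in \<open>K1\<close>.
\<close>

lemma star_part_eq:
  assumes "super_partition \<Lambda>" "i \<in> {1..length \<Lambda>}"
  shows "int (star_part \<Lambda> i) = int (circ_part \<Lambda> i) - int (sgm \<Lambda> i)"
proof (cases "part \<Lambda> i \<in> \<int>")
  case False
  have "\<lfloor>part \<Lambda> i - 1 / 2\<rfloor> + 1 = \<lfloor>part \<Lambda> i - 1 / 2 + of_int 1\<rfloor>"
    by (rule floor_add_int)
  also have "part \<Lambda> i - 1 / 2 + of_int 1 = part \<Lambda> i + 1 / 2"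
    by simp
  finally show ?thesis
    using False super_partition_part_ge [OF assms]
    by (simp add: circ_part_def star_part_def sgm_def)
qed (simp add: circ_part_def star_part_def sgm_def)

lemma part_beyond_length:
  "\<forall>i>length \<Lambda>. circ_part \<Lambda> i = 0" "\<forall>i>length \<Lambda>. star_part \<Lambda> i = 0"
  by (simp_all add: circ_part_def star_part_def sgm_def part_def)

lemma plength_circ_part:
  assumes "super_partition \<Lambda>"
  shows "plength (circ_part \<Lambda>) = length \<Lambda>"
proof -
  have "{i. 1 \<le> i \<and> circ_part \<Lambda> i \<noteq> 0} = {1..length \<Lambda>}"
  proof (rule set_eqI)
    fix i
    show "i \<in> {i. 1 \<le> i \<and> circ_part \<Lambda> i \<noteq> 0} \<longleftrightarrow> i \<in> {1..length \<Lambda>}"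
      using circ_part_pos [OF assms, of i] part_beyond_length(1) [of \<Lambda>]
      by (cases "i \<le> length \<Lambda>") auto
  qed
  thus ?thesis by (simp add: plength_def)
qed


section \<open>Sums over boxes\<close>

text \<open>
  Row \<open>i\<close> is a geometric series, which \<open>x - 1\<close> turns into \<open>(x ^ \<mu> i - 1) * y ^ (i - 1)\<close>. The
  contributions of the \<open>- 1\<close> form a geometric series in \<open>y\<close>, which \<open>y - 1\<close> turns into \<open>1 - y ^ l\<close>.
  Raising \<open>l\<close> past the last nonempty row changes nothing, since an empty row contributes opposite
  amounts to the two terms on the right.
\<close>

lemma sum_boxes_geometric:
  fixes x y :: "'k::field"
  assumes "\<forall>i>l. \<mu> i = 0"
  shows "(y - 1) * (x - 1) * (\<Sum>(i, j)\<in>boxes \<mu>. x ^ (j - 1) * y ^ (i - 1)) =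
           1 - y ^ l + (y - 1) * (\<Sum>i=1..l. x ^ \<mu> i * y ^ (i - 1))"
proof -
  have geo: "(z - 1) * (\<Sum>i=1..n. z ^ (i - 1)) = z ^ n - 1" for z :: 'k and n
    by (induction n) (simp_all add: algebra_simps)
  have "boxes \<mu> = (SIGMA i:{1..l}. {1..\<mu> i})"
    using assms by (force simp: boxes_def not_le [symmetric])
  hence "(\<Sum>(i, j)\<in>boxes \<mu>. x ^ (j - 1) * y ^ (i - 1)) =
           (\<Sum>i=1..l. (\<Sum>j=1..\<mu> i. x ^ (j - 1)) * y ^ (i - 1))"
    by (simp add: sum.Sigma sum_distrib_right)
  hence "(x - 1) * (\<Sum>(i, j)\<in>boxes \<mu>. x ^ (j - 1) * y ^ (i - 1)) =
           (x - 1) * (\<Sum>i=1..l. (\<Sum>j=1..\<mu> i. x ^ (j - 1)) * y ^ (i - 1))"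
    by (simp only:)
  also have "\<dots> = (\<Sum>i=1..l. ((x - 1) * (\<Sum>j=1..\<mu> i. x ^ (j - 1))) * y ^ (i - 1))"
    by (subst sum_distrib_left) (simp only: mult.assoc)
  also have "\<dots> = (\<Sum>i=1..l. x ^ \<mu> i * y ^ (i - 1)) - (\<Sum>i=1..l. y ^ (i - 1))"
    unfolding geo by (simp add: left_diff_distrib sum_subtractf)
  finally show ?thesis
    unfolding mult.assoc [of "y - 1"] right_diff_distrib [of "y - 1" "sum _ _"]
    by (simp only: right_diff_distrib [of "y - 1" "sum _ _"] geo) simp
qed

text \<open>
  The specialization \<open>x = 1 / q\<close>, \<open>y = t\<close>, in the form in which it meets the expansions at \<open>0\<close>.
\<close>

lemma sum_boxes_zero:
  fixes q t :: "'k::field"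
  assumes "\<forall>i>l. \<mu> i = 0"
  shows "(t - 1) * (inverse q - 1) * (\<Sum>(i, j)\<in>boxes \<mu>. q powi (1 - int j) * t powi (int i - 1)) =
           1 - t ^ l + (t - 1) * (\<Sum>i=1..l. q powi (- int (\<mu> i)) * t powi (int i - 1))"
proof -
  have *: "t powi (int i - 1) = t ^ (i - 1)" "q powi (1 - int i) = inverse q ^ (i - 1)"
    if "i \<ge> 1" for i
    using that by (auto simp: power_int_def nat_diff_distrib)
  have "(\<Sum>(i, j)\<in>boxes \<mu>. q powi (1 - int j) * t powi (int i - 1)) =
        (\<Sum>(i, j)\<in>boxes \<mu>. inverse q ^ (j - 1) * t ^ (i - 1))"
    by (rule sum.cong) (auto simp: boxes_def *)
  moreover have "(\<Sum>i=1..l. q powi (- int (\<mu> i)) * t powi (int i - 1)) =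
        (\<Sum>i=1..l. inverse q ^ \<mu> i * t ^ (i - 1))"
    by (rule sum.cong) (auto simp: * power_int_minus power_inverse)
  ultimately show ?thesis
    using sum_boxes_geometric [of l \<mu> t "inverse q", OF assms] by simp
qed

text \<open>
  This is \<open>sum_boxes_zero\<close> with \<open>q\<close> and \<open>t\<close> inverted, in the form in which it meets the expansions at \<open>\<infinity>\<close>.
\<close>

lemma sum_boxes_inf:
  fixes q t :: "'k::field"
  assumes "\<forall>i>l. \<mu> i = 0"
  shows "(inverse t - 1) * (q - 1) * (\<Sum>(i, j)\<in>boxes \<mu>. q powi (int j - 1) * t powi (1 - int i)) =
           1 - inverse t ^ l + (inverse t - 1) * (\<Sum>i=1..l. q powi (int (\<mu> i)) * t powi (1 - int i))"
proof -
  have inv: "inverse x powi n = x powi (- n)" for x :: 'k and n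
    by (simp add: power_int_minus power_int_inverse)
  show ?thesis
    using sum_boxes_zero [of l \<mu> "inverse t" "inverse q", OF assms] by (simp add: inv)
qed


section \<open>Logarithmic expansions of the currents\<close>

text \<open>
  In each row the zero is \<open>1 / t\<close> times the pole, so at \<open>0\<close> the product over the \<open>l\<close> rows has leading
  coefficient \<open>t\<^sup>-\<^sup>l\<close>. This cancels the power of \<open>t\<close> in the prefactor, and the leading coefficient
  \<open>- 1 / u\<close> does not depend on \<open>\<Lambda>\<close>.
\<close>

lemma log_expansion_K1:
  fixes q t u :: "'k::field"
  assumes nz: "q \<noteq> 0" "t \<noteq> 0" "u \<noteq> 0" and "super_partition \<Lambda>"
  defines "l \<equiv> length \<Lambda>"
  shows "log_expansion (expand_zero (K1 q t u \<Lambda>)) 0 (- inverse u)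
           (inverse u * (t ^ l - (t - 1) * (\<Sum>i=1..l. q powi (- int (star_part \<Lambda> i)) * t powi (int i - 1))))"
    and "log_expansion (expand_inf (K1 q t u \<Lambda>)) 1 1
           (u * (inverse t ^ l - (inverse t - 1) * (\<Sum>i=1..l. q powi (int (star_part \<Lambda> i)) * t powi (1 - int i))))"
proof -
  define s where "s i = int (star_part \<Lambda> i)" for i
  define a where "a i = q powi s i * t powi (- int i) * u" for i
  define b where "b i = q powi s i * t powi (1 - int i) * u" for i
  define c where "c = t powi (- int l) * u"
  have K1: "K1 q t u \<Lambda> = 1 / (zvar - cst c) * (\<Prod>i=1..l. (zvar - cst (a i)) / (zvar - cst (b i)))"
    unfolding K1_def Let_def plength_circ_part [OF assms(4)] l_def [symmetric] c_def
    by (intro arg_cong2 [of _ _ _ _ "(*)"] refl prod.cong)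
      (simp_all add: a_def b_def s_def star_part_eq [OF assms(4)] l_def del: diff_fract)
  have c0: "c \<noteq> 0" and ab0: "a i \<noteq> 0" "b i \<noteq> 0" for i
    using nz by (simp_all add: a_def b_def c_def)
  \<comment> \<open>This ratio makes the leading coefficient telescope.\<close>
  have tb: "b i = t * a i" for i
    using nz by (simp add: a_def b_def power_int_diff power_int_minus divide_simps)
  have pole_zero: "log_expansion (expand_zero (1 / (zvar - cst c))) 0 (1 / (- c)) (0 - - inverse c)"
    using log_expansion_divide [OF log_expansion_one log_expansion_zero_linear [OF c0]]
    unfolding expand_zero_divide [OF linear_factor_nonzero] expand_zero_one by simp
  have pole_inf: "log_expansion (expand_inf (1 / (zvar - cst c))) 1 1 (0 - - c)"
    using log_expansion_divide [OF log_expansion_one log_expansion_inf_linear [of c]]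
    unfolding expand_inf_divide [OF linear_factor_nonzero] expand_inf_one by simp
  have "log_expansion (expand_zero (K1 q t u \<Lambda>)) 0
          (1 / (- c) * (\<Prod>i=1..l. a i / b i))
          ((0 - - inverse c) + (\<Sum>i=1..l. inverse (b i) - inverse (a i)))"
    using log_expansion_mult [OF pole_zero log_expansion_zero_prod [of "{1..l}" a b]] ab0
    unfolding K1 expand_zero_mult by simp
  moreover have "1 / (- c) * (\<Prod>i=1..l. a i / b i) = - inverse u"
    using nz ab0 by (simp add: tb c_def power_int_minus divide_simps)
  moreover have "(0 - - inverse c) + (\<Sum>i=1..l. inverse (b i) - inverse (a i)) =
    inverse u * (t ^ l - (t - 1) * (\<Sum>i=1..l. q powi (- s i) * t powi (int i - 1)))"
  proof -
    have "inverse (b i) - inverse (a i) = - (inverse u * ((t - 1) * (q powi (- s i) * t powi (int i - 1))))" for i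
      using nz by (simp add: a_def b_def power_int_diff power_int_minus field_simps)
    moreover have "inverse c = inverse u * t ^ l"
      using nz by (simp add: c_def power_int_minus)
    ultimately show ?thesis
      by (simp add: sum_distrib_left right_diff_distrib sum_negf)
  qed
  ultimately show "log_expansion (expand_zero (K1 q t u \<Lambda>)) 0 (- inverse u)
           (inverse u * (t ^ l - (t - 1) * (\<Sum>i=1..l. q powi (- int (star_part \<Lambda> i)) * t powi (int i - 1))))"
    by (simp add: s_def)
  have "log_expansion (expand_inf (K1 q t u \<Lambda>)) 1 1
          ((0 - - c) + (\<Sum>i=1..l. b i - a i))"
    using log_expansion_mult [OF pole_inf log_expansion_inf_prod [of a b "{1..l}"]]
    unfolding K1 expand_inf_mult by simp
  moreover have "(0 - - c) + (\<Sum>i=1..l. b i - a i) =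
    u * (inverse t ^ l - (inverse t - 1) * (\<Sum>i=1..l. q powi s i * t powi (1 - int i)))"
  proof -
    have "b i - a i = - (u * ((inverse t - 1) * (q powi s i * t powi (1 - int i))))" for i
      using nz by (simp add: a_def b_def power_int_diff power_int_minus field_simps)
    moreover have "c = u * inverse t ^ l"
      using nz by (simp add: c_def power_int_minus power_inverse)
    ultimately show ?thesis
      by (simp add: sum_distrib_left right_diff_distrib sum_negf)
  qed
  ultimately show "log_expansion (expand_inf (K1 q t u \<Lambda>)) 1 1
           (u * (inverse t ^ l - (inverse t - 1) * (\<Sum>i=1..l. q powi (int (star_part \<Lambda> i)) * t powi (1 - int i))))"
    by (simp add: s_def)
qed

text \<open>
  With \<open>w = u (t / q)\<^sup>1\<^sup>/\<^sup>2\<close> all half-integral powers disappear: the zeros are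
  \<open>q\<^sup>\<lambda> t\<^sup>1\<^sup>-\<^sup>i w\<close>, the poles \<open>q\<^sup>\<lambda> t\<^sup>-\<^sup>i w\<close>, and the prefactor is \<open>z - t\<^sup>-\<^sup>l w\<close>, where \<open>\<lambda>\<close> is the
  length of row \<open>i\<close> of \<open>\<Lambda>\<^sup>\<circledast>\<close>. Zeros and poles have exchanged roles compared with \<open>K1\<close>, which
  reverses the signs of the logarithmic coefficients.
\<close>

lemma log_expansion_K2:
  fixes q t u sq st :: "'k::field"
  assumes nz: "sq \<noteq> 0" "st \<noteq> 0" "u \<noteq> 0" and "sq ^ 2 = q" "st ^ 2 = t" and "super_partition \<Lambda>"
  defines "l \<equiv> length \<Lambda>" and "w \<equiv> u * (st / sq)"
  shows "log_expansion (expand_zero (K2 sq st t u \<Lambda>)) 0 (- w)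
           (- inverse w * (t ^ l - (t - 1) * (\<Sum>i=1..l. q powi (- int (circ_part \<Lambda> i)) * t powi (int i - 1))))"
    and "log_expansion (expand_inf (K2 sq st t u \<Lambda>)) (- 1) 1
           (- w * (inverse t ^ l - (inverse t - 1) * (\<Sum>i=1..l. q powi (int (circ_part \<Lambda> i)) * t powi (1 - int i))))"
proof -
  define s where "s i = int (circ_part \<Lambda> i)" for i
  define a where "a i = q powi s i * t powi (1 - int i) * w" for i
  define b where "b i = q powi s i * t powi (- int i) * w" for i
  define c where "c = t powi (- int l) * w"
  have w0: "w \<noteq> 0" and t0: "t \<noteq> 0" and q0: "q \<noteq> 0"
    using nz unfolding w_def assms(4) [symmetric] assms(5) [symmetric] by simp_all
  have sq: "sq powi (2 * m) = q powi m" and st: "st powi (2 * m) = t powi m" for m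
    using power_int_mult [of sq 2 m] power_int_mult [of st 2 m] assms(4,5) by simp_all
  \<comment> \<open>The exponents in \<open>K2\<close> are odd, hence half-integral as powers of \<open>q\<close> and \<open>t\<close>; the leftover
      roots are collected in \<open>w\<close>.\<close>
  have sq_odd: "sq powi (2 * m - 1) = q powi m / sq" and st_odd: "st powi (2 * m + 1) = t powi m * st" for m
    using nz by (simp_all add: power_int_diff power_int_add sq st)
  have a: "sq powi (2 * s i - 1) * st powi (3 - 2 * int i) * u = a i" for i
  proof -
    have *: "3 - 2 * int i = 2 * (1 - int i) + 1" by simp
    show ?thesis unfolding * sq_odd st_odd by (simp add: a_def w_def)
  qed
  have b: "sq powi (2 * s i - 1) * st powi (1 - 2 * int i) * u = b i" for i
  proof -
    have *: "1 - 2 * int i = 2 * (- int i) + 1" by simp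
    show ?thesis unfolding * sq_odd st_odd by (simp add: b_def w_def)
  qed
  have c: "st / sq * t powi (- int l) * u = c"
    by (simp add: c_def w_def)
  have K2: "K2 sq st t u \<Lambda> = (zvar - cst c) * (\<Prod>i=1..l. (zvar - cst (a i)) / (zvar - cst (b i)))"
    unfolding K2_def Let_def plength_circ_part [OF assms(6)] l_def [symmetric]
      s_def [symmetric] a b c ..
  have c0: "c \<noteq> 0" and ab0: "a i \<noteq> 0" "b i \<noteq> 0" for i
    using w0 t0 q0 by (simp_all add: a_def b_def c_def)
  have ta: "a i = t * b i" for i
    using t0 by (simp add: a_def b_def power_int_diff power_int_minus divide_simps)
  have "log_expansion (expand_zero (K2 sq st t u \<Lambda>)) 0
          (- c * (\<Prod>i=1..l. a i / b i))
          (- inverse c + (\<Sum>i=1..l. inverse (b i) - inverse (a i)))"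
    using log_expansion_mult [OF log_expansion_zero_linear [OF c0]
        log_expansion_zero_prod [of "{1..l}" a b]] ab0
    unfolding K2 expand_zero_mult by simp
  moreover have "- c * (\<Prod>i=1..l. a i / b i) = - w"
    using t0 ab0 by (simp add: ta c_def power_int_minus divide_simps)
  moreover have "- inverse c + (\<Sum>i=1..l. inverse (b i) - inverse (a i)) =
    - inverse w * (t ^ l - (t - 1) * (\<Sum>i=1..l. q powi (- s i) * t powi (int i - 1)))"
  proof -
    have "inverse (b i) - inverse (a i) = inverse w * ((t - 1) * (q powi (- s i) * t powi (int i - 1)))" for i
      using w0 t0 q0 by (simp add: a_def b_def power_int_diff power_int_minus field_simps)
    moreover have "inverse c = inverse w * t ^ l"
      by (simp add: c_def power_int_minus)
    ultimately show ?thesis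
      by (simp add: sum_distrib_left right_diff_distrib sum_negf)
  qed
  ultimately show "log_expansion (expand_zero (K2 sq st t u \<Lambda>)) 0 (- w)
           (- inverse w * (t ^ l - (t - 1) * (\<Sum>i=1..l. q powi (- int (circ_part \<Lambda> i)) * t powi (int i - 1))))"
    by (simp add: s_def)
  have "log_expansion (expand_inf (K2 sq st t u \<Lambda>)) (- 1) 1 (- c + (\<Sum>i=1..l. b i - a i))"
    using log_expansion_mult [OF log_expansion_inf_linear [of c]
        log_expansion_inf_prod [of a b "{1..l}"]]
    unfolding K2 expand_inf_mult by simp
  moreover have "- c + (\<Sum>i=1..l. b i - a i) =
    - w * (inverse t ^ l - (inverse t - 1) * (\<Sum>i=1..l. q powi s i * t powi (1 - int i)))"
  proof -
    have "b i - a i = w * ((inverse t - 1) * (q powi s i * t powi (1 - int i)))" for i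
      using t0 by (simp add: a_def b_def power_int_diff power_int_minus field_simps)
    moreover have "c = w * inverse t ^ l"
      by (simp add: c_def power_int_minus power_inverse)
    ultimately show ?thesis
      by (simp add: sum_distrib_left right_diff_distrib sum_negf)
  qed
  ultimately show "log_expansion (expand_inf (K2 sq st t u \<Lambda>)) (- 1) 1
           (- w * (inverse t ^ l - (inverse t - 1) * (\<Sum>i=1..l. q powi (int (circ_part \<Lambda> i)) * t powi (1 - int i))))"
    by (simp add: s_def)
qed

section \<open>From the currents to the Hamiltonians\<close>

context super_fock
begin

text \<open>
  The first-order term of the exponential is the first-order term of the exponent, since the
  \<open>k\<close>-th power of a series without constant term starts in degree \<open>k\<close>.
\<close>

lemma ops_exp_one:
  assumes "\<And>v. A 0 v = 0"
  shows "ops_exp scale A 1 v = A 1 v"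
  using assms by (simp add: ops_exp_def ops_mult_def)

lemma scalar_on_kets:
  assumes "Vector_Spaces.linear scale scale f"
    and "\<And>\<Lambda>. super_partition \<Lambda> \<Longrightarrow> f (ket \<Lambda>) = scale c (ket \<Lambda>)"
  shows "f v = scale c v"
proof -
  have pair: "vector_space_pair scale scale" by unfold_locales
  have "v \<in> span (ket ` {\<Lambda>. super_partition \<Lambda>})"
    by (simp only: ket_span UNIV_I)
  thus ?thesis
  proof (rule vector_space_pair.linear_eq_on [OF pair assms(1) linear_scale_self])
    fix b assume "b \<in> ket ` {\<Lambda>. super_partition \<Lambda>}"
    then obtain M where "b = ket M" "super_partition M" by blast
    thus "f b = scale c b" using assms(2) by metis
  qed
qed

text \<open>
  The constant \<open>c\<close> must be the same for all super partitions \<open>M\<close>: then the leading mode \<open>Km i 0\<close> is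
  the scalar \<open>c\<close> on every vector, in particular on \<open>H i (- 1) (ket \<Lambda>)\<close>, and can be cancelled.
\<close>

lemma H_minus_one_ket:
  assumes "i \<in> {1, 2}" "super_partition \<Lambda>"
    and "\<And>M. super_partition M \<Longrightarrow>
      log_expansion (expand_zero (K_eig q t u sq st i M)) 0 c (h M)"
  shows "H i (- 1) (ket \<Lambda>) = scale (- h \<Lambda>) (ket \<Lambda>)"
proof -
  note L = assms(3) [OF assms(2)]
  \<comment> \<open>The modes are numbered from the leading term of the expansion.\<close>
  have index: "int 0 = 0" "int 1 = 0 + 1"
    by simp_all
  have K0: "Km i 0 v = scale c v" for v
  proof (rule scalar_on_kets [OF Km_linear [OF assms(1)]])
    fix M assume M: "super_partition M"
    show "Km i 0 (ket M) = scale c (ket M)"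
      unfolding Km_ket [OF assms(1) M] index log_expansion_nth(1) [OF assms(3) [OF M]] ..
  qed
  have "scale c (- H i (- 1) (ket \<Lambda>)) = Km i 1 (ket \<Lambda>)"
    unfolding Km_exp [OF assms(1), of 1] K0 by (subst ops_exp_one) simp_all
  also have "\<dots> = scale c (scale (h \<Lambda>) (ket \<Lambda>))"
    unfolding Km_ket [OF assms(1,2)] index log_expansion_nth(2) [OF L] scale_scale ..
  finally have "scale c (- H i (- 1) (ket \<Lambda>)) = scale c (scale (h \<Lambda>) (ket \<Lambda>))" .
  hence "- H i (- 1) (ket \<Lambda>) = scale (h \<Lambda>) (ket \<Lambda>)"
    by (rule scale_left_imp_eq [OF log_expansion_nth(3) [OF L]])
  thus ?thesis by (metis minus_minus scale_minus_left)
qed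

text \<open>
  The same at infinity. The order \<open>- shift_param i\<close> is the one at which the expansion of
  \<open>z\<^sup>r K\<^sub>i\<^sup>+(z)\<close> in \<open>1 / z\<close> begins.
\<close>

lemma H_plus_one_ket:
  assumes "i \<in> {1, 2}" "super_partition \<Lambda>"
    and "\<And>M. super_partition M \<Longrightarrow>
      log_expansion (expand_inf (K_eig q t u sq st i M)) (- shift_param i) c (h M)"
  shows "H i 1 (ket \<Lambda>) = scale (h \<Lambda>) (ket \<Lambda>)"
proof -
  note L = assms(3) [OF assms(2)]
  have index: "int 0 - shift_param i = - shift_param i" "int 1 - shift_param i = - shift_param i + 1"
    by simp_all
  have K0: "Kp i 0 v = scale c v" for v
  proof (rule scalar_on_kets [OF Kp_linear [OF assms(1)]])
    fix M assume M: "super_partition M"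
    show "Kp i 0 (ket M) = scale c (ket M)"
      unfolding Kp_ket [OF assms(1) M] index log_expansion_nth(1) [OF assms(3) [OF M]] ..
  qed
  have "scale c (H i 1 (ket \<Lambda>)) = Kp i 1 (ket \<Lambda>)"
    unfolding Kp_exp [OF assms(1), of 1] K0 by (subst ops_exp_one) simp_all
  also have "\<dots> = scale c (scale (h \<Lambda>) (ket \<Lambda>))"
    unfolding Kp_ket [OF assms(1,2)] index log_expansion_nth(2) [OF L] scale_scale ..
  finally have "scale c (H i 1 (ket \<Lambda>)) = scale c (scale (h \<Lambda>) (ket \<Lambda>))" .
  thus ?thesis
    by (rule scale_left_imp_eq [OF log_expansion_nth(3) [OF L]])
qed

end

theorem proposition2p1:
  fixes scale :: "'k::field_char_0 \<Rightarrow> 'v::ab_group_add \<Rightarrow> 'v"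
    and q t u sq st :: 'k
    and ket :: "rat list \<Rightarrow> 'v"
    and Km Kp :: "nat \<Rightarrow> 'v op_series"
    and H :: "nat \<Rightarrow> int \<Rightarrow> 'v \<Rightarrow> 'v"
    and \<Lambda> :: "rat list"
  assumes "super_fock scale q t u sq st ket Km Kp H"
    and "super_partition \<Lambda>"
  shows "\<exists>h1m h1p h2m h2p :: 'k.
    H 1 (-1) (ket \<Lambda>) = scale h1m (ket \<Lambda>) \<and>
    H 1 1 (ket \<Lambda>) = scale h1p (ket \<Lambda>) \<and>
    H 2 (-1) (ket \<Lambda>) = scale h2m (ket \<Lambda>) \<and>
    H 2 1 (ket \<Lambda>) = scale h2p (ket \<Lambda>) \<and>
    1 - u * (st / sq) * h2m =
      (t - 1) * (inverse q - 1) *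
        (\<Sum>(i, j)\<in>boxes (circ_part \<Lambda>). q powi (1 - int j) * t powi (int i - 1)) \<and>
    1 + u * h1m =
      (t - 1) * (inverse q - 1) *
        (\<Sum>(i, j)\<in>boxes (star_part \<Lambda>). q powi (1 - int j) * t powi (int i - 1)) \<and>
    1 + inverse u * (sq / st) * h2p =
      (inverse t - 1) * (q - 1) *
        (\<Sum>(i, j)\<in>boxes (circ_part \<Lambda>). q powi (int j - 1) * t powi (1 - int i)) \<and>
    1 - inverse u * h1p =
      (inverse t - 1) * (q - 1) *
        (\<Sum>(i, j)\<in>boxes (star_part \<Lambda>). q powi (int j - 1) * t powi (1 - int i))"
proof -
  interpret super_fock scale q t u sq st ket Km Kp H by (rule assms(1))
  have q0: "q \<noteq> 0" and t0: "t \<noteq> 0" and u0: "u \<noteq> 0" and sq: "sq ^ 2 = q" and st: "st ^ 2 = t"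
    using generic by (auto simp: generic_parameters_def)
  hence sq0: "sq \<noteq> 0" and st0: "st \<noteq> 0" by auto
  define w where "w = u * (st / sq)"
  have w0: "w \<noteq> 0" and w_inv: "inverse u * (sq / st) = inverse w"
    using u0 sq0 st0 by (simp_all add: w_def divide_simps)
  let ?l = "length \<Lambda>"
  note K1 = log_expansion_K1 [OF q0 t0 u0]
  note K2 = log_expansion_K2 [OF sq0 st0 u0 sq st, folded w_def]
  have H1m: "H 1 (- 1) (ket \<Lambda>) = scale (- (inverse u * (t ^ ?l - (t - 1) *
      (\<Sum>i=1..?l. q powi (- int (star_part \<Lambda> i)) * t powi (int i - 1))))) (ket \<Lambda>)"
    by (rule H_minus_one_ket [OF _ assms(2)]) (use K1(1) in \<open>simp_all add: K_eig_def\<close>)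
  have H1p: "H 1 1 (ket \<Lambda>) = scale (u * (inverse t ^ ?l - (inverse t - 1) *
      (\<Sum>i=1..?l. q powi (int (star_part \<Lambda> i)) * t powi (1 - int i)))) (ket \<Lambda>)"
    by (rule H_plus_one_ket [OF _ assms(2)]) (use K1(2) in \<open>simp_all add: K_eig_def shift_param_def\<close>)
  have H2m: "H 2 (- 1) (ket \<Lambda>) = scale (- (- inverse w * (t ^ ?l - (t - 1) *
      (\<Sum>i=1..?l. q powi (- int (circ_part \<Lambda> i)) * t powi (int i - 1))))) (ket \<Lambda>)"
    by (rule H_minus_one_ket [OF _ assms(2)]) (use K2(1) in \<open>simp_all add: K_eig_def\<close>)
  have H2p: "H 2 1 (ket \<Lambda>) = scale (- w * (inverse t ^ ?l - (inverse t - 1) *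
      (\<Sum>i=1..?l. q powi (int (circ_part \<Lambda> i)) * t powi (1 - int i)))) (ket \<Lambda>)"
    by (rule H_plus_one_ket [OF _ assms(2)]) (use K2(2) in \<open>simp_all add: K_eig_def shift_param_def\<close>)
  show ?thesis
    unfolding w_inv w_def [symmetric]
      sum_boxes_zero [of ?l "circ_part \<Lambda>", OF part_beyond_length(1)]
      sum_boxes_zero [of ?l "star_part \<Lambda>", OF part_beyond_length(2)]
      sum_boxes_inf [of ?l "circ_part \<Lambda>", OF part_beyond_length(1)]
      sum_boxes_inf [of ?l "star_part \<Lambda>", OF part_beyond_length(2)]
    by (intro exI conjI, rule H1m, rule H1p, rule H2m, rule H2p)
      (use u0 w0 in \<open>simp_all add: mult.assoc [symmetric]\<close>)
qed

end
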